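(* Let $r$ be a positive number and let $G$ be a graph without isolated edges, with $m$ connected components $G_1,G_2,\ldots,G_m$. Then $$\chi_{r-vsdt}(G)=\max\{\chi_{r-vsdt}(G_i) : i=1,2,\ldots,m\}.$$
   Context: All graphs are finite, simple and undirected. For a vertex $u$ of $G$, let $N\langle u\rangle = N[u]\cup\{uv : v\in N(u)\}$, where $N(u)$ and $N[u]=N(u)\cup\{u\}$ are the open and closed neighborhoods; so $N\langle u\rangle$ consists of $u$, its neighbors and its incident edges. A proper $\kappa$-total coloring of $G$ is a map $f:V(G)\cup E(G)\to\{1,\dots,\kappa\}$ such that any two adjacent vertices, any two edges sharing an endpoint, and any vertex and incident edge receive different colors. Put $C_f\langle u\rangle=\{f(x): x\in N\langle u\rangle\}$. For a graph $G$ with no isolated edges (no connected component is $K_2$) and a positive number $r$, a $\kappa$-$r$-vertex-strongly-distinguishing total coloring ($\kappa$-$D(r)$-VSDTC) of $G$ is a proper $\kappa$-total coloring $f$ such that $C_f\langle u\rangle\neq C_f\langle v\rangle$ for any two distinct vertices $u,v$ at distance at most $r$ (vertices in different components are at infinite distance). $\chi_{r-vsdt}(G)$ is the minimum $\kappa$ for which $G$ admits a $\kappa$-$D(r)$-VSDTC. *)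

theory Defs
  imports "HOL-Library.FuncSet" "HOL-Library.Extended_Real"
begin

record 'a ugraph =
  verts :: "'a set"
  edges :: "'a set set"

text \<open>As usual in graph theory, a graph has at least one vertex.\<close>

definition simple_graph :: "'a ugraph \<Rightarrow> bool" where
  "simple_graph G \<longleftrightarrow> finite (verts G) \<and> verts G \<noteq> {} \<and>
     (\<forall>e\<in>edges G. e \<subseteq> verts G \<and> card e = 2)"

definition adj :: "'a ugraph \<Rightarrow> ('a \<times> 'a) set" where
  "adj G = {(u, v). {u, v} \<in> edges G}"

text \<open>
  A pair in the relational power \<open>adj G ^^ n\<close> is a pair of vertices joined by a walk of
  length \<open>n\<close>; the infimum of the empty set in \<open>enat\<close> is \<open>\<infinity>\<close>.
\<close>

definition graph_dist :: "'a ugraph \<Rightarrow> 'a \<Rightarrow> 'a \<Rightarrow> enat" where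
  "graph_dist G u v = Inf {enat n | n. (u, v) \<in> adj G ^^ n}"

definition induced_subgraph :: "'a ugraph \<Rightarrow> 'a set \<Rightarrow> 'a ugraph" where
  "induced_subgraph G S = \<lparr>verts = S, edges = {e \<in> edges G. e \<subseteq> S}\<rparr>"

definition components :: "'a ugraph \<Rightarrow> 'a ugraph set" where
  "components G = {induced_subgraph G {v. (u, v) \<in> (adj G)\<^sup>*} | u. u \<in> verts G}"

definition is_K2 :: "'a ugraph \<Rightarrow> bool" where
  "is_K2 G \<longleftrightarrow> (\<exists>u v. u \<noteq> v \<and> verts G = {u, v} \<and> edges G = {{u, v}})"

definition no_isolated_edges :: "'a ugraph \<Rightarrow> bool" where
  "no_isolated_edges G \<longleftrightarrow> (\<forall>H\<in>components G. \<not> is_K2 H)"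

definition nbhd :: "'a ugraph \<Rightarrow> 'a \<Rightarrow> 'a set" where
  "nbhd G u = {v \<in> verts G. {u, v} \<in> edges G}"

definition closed_nbhd :: "'a ugraph \<Rightarrow> 'a \<Rightarrow> 'a set" where
  "closed_nbhd G u = nbhd G u \<union> {u}"

text \<open>
  The disjoint union of vertices and edges is encoded in the sum type \<open>'a + 'a set\<close>:
  \<open>Inl v\<close> is the vertex \<open>v\<close>, \<open>Inr e\<close> is the edge \<open>e\<close>.
\<close>

definition total_nbhd :: "'a ugraph \<Rightarrow> 'a \<Rightarrow> ('a + 'a set) set" where
  "total_nbhd G u = closed_nbhd G u <+> {{u, v} | v. v \<in> nbhd G u}"

definition proper_total_coloring :: "'a ugraph \<Rightarrow> nat \<Rightarrow> ('a + 'a set \<Rightarrow> nat) \<Rightarrow> bool" where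
  "proper_total_coloring G \<kappa> f \<longleftrightarrow>
     f \<in> (verts G <+> edges G) \<rightarrow> {1..\<kappa>} \<and>
     (\<forall>u\<in>verts G. \<forall>v\<in>verts G. {u, v} \<in> edges G \<longrightarrow> f (Inl u) \<noteq> f (Inl v)) \<and>
     (\<forall>e\<in>edges G. \<forall>e'\<in>edges G. e \<noteq> e' \<and> e \<inter> e' \<noteq> {} \<longrightarrow> f (Inr e) \<noteq> f (Inr e')) \<and>
     (\<forall>v\<in>verts G. \<forall>e\<in>edges G. v \<in> e \<longrightarrow> f (Inl v) \<noteq> f (Inr e))"

definition color_set :: "'a ugraph \<Rightarrow> ('a + 'a set \<Rightarrow> nat) \<Rightarrow> 'a \<Rightarrow> nat set" where
  "color_set G f u = f ` total_nbhd G u"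

definition vsdtc :: "real \<Rightarrow> 'a ugraph \<Rightarrow> nat \<Rightarrow> ('a + 'a set \<Rightarrow> nat) \<Rightarrow> bool" where
  "vsdtc r G \<kappa> f \<longleftrightarrow> proper_total_coloring G \<kappa> f \<and>
     (\<forall>u\<in>verts G. \<forall>v\<in>verts G. u \<noteq> v \<and> ereal_of_enat (graph_dist G u v) \<le> ereal r \<longrightarrow>
        color_set G f u \<noteq> color_set G f v)"

text \<open>
  Only meaningful for \<open>no_isolated_edges G\<close>. Such a graph always has a coloring as required
  (give all vertices and edges distinct colors), so the minimum exists.
\<close>

definition chi_vsdt :: "real \<Rightarrow> 'a ugraph \<Rightarrow> nat" where
  "chi_vsdt r G = (LEAST \<kappa>. \<exists>f. vsdtc r G \<kappa> f)"

end

theory Submission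
  imports Defs
begin

text \<open>
  A coloring is admissible for \<open>G\<close> iff it is admissible for every component, because total
  neighborhoods and finite distances are computed inside a component. As components are disjoint,
  colorings of the components can be glued, so \<open>G\<close> and the family of its components admit
  the same numbers of colors. Some number is always admissible: if all colors are distinct, two
  vertices with the same color set have the same incident edges, so a component containing both
  is a \<open>K\<^sub>2\<close>.
\<close>

section \<open>Adjacency, reachability and edges in a simple graph\<close>

lemma adj_sym: "(u, v) \<in> adj G \<Longrightarrow> (v, u) \<in> adj G"
  by (simp add: adj_def insert_commute)

lemma adj_rtrancl_sym: "(u, v) \<in> (adj G)\<^sup>* \<Longrightarrow> (v, u) \<in> (adj G)\<^sup>*"
  by (metis adj_sym symI sym_rtrancl symD)

lemma adj_verts:
  assumes "simple_graph G" "(u, v) \<in> adj G"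
  shows "u \<in> verts G" "v \<in> verts G" "u \<noteq> v"
  using assms by (auto simp: simple_graph_def adj_def dest!: bspec)

lemma adj_rtrancl_verts:
  assumes "simple_graph G" "(u, v) \<in> (adj G)\<^sup>*" "u \<in> verts G"
  shows "v \<in> verts G"
  using assms(2,3) by induction (auto dest: adj_verts[OF assms(1)])

lemma edge_other_end:
  assumes "simple_graph G" "e \<in> edges G" "u \<in> e"
  obtains v where "e = {u, v}"
proof -
  have "card e = 2" using assms by (auto simp: simple_graph_def)
  then show thesis using assms(3) that by (auto simp: card_2_iff)
qed

lemma finite_edges: "simple_graph G \<Longrightarrow> finite (edges G)"
  by (rule finite_subset[of _ "Pow (verts G)"]) (auto simp: simple_graph_def)

section \<open>Components as a partition of the vertices and edges\<close>

lemma component_verts_subset: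
  "simple_graph G \<Longrightarrow> C \<in> components G \<Longrightarrow> verts C \<subseteq> verts G"
  by (auto simp: components_def induced_subgraph_def intro: adj_rtrancl_verts)

lemma component_edges_subset: "C \<in> components G \<Longrightarrow> edges C \<subseteq> edges G"
  by (auto simp: components_def induced_subgraph_def)

lemma component_edge_verts: "C \<in> components G \<Longrightarrow> e \<in> edges C \<Longrightarrow> e \<subseteq> verts C"
  by (auto simp: components_def induced_subgraph_def)

lemma verts_in_component:
  assumes "u \<in> verts G"
  obtains C where "C \<in> components G" "u \<in> verts C"
proof
  show "induced_subgraph G {v. (u, v) \<in> (adj G)\<^sup>*} \<in> components G"
    using assms by (auto simp: components_def)
qed (simp add: induced_subgraph_def)

text \<open>Reachability is symmetric and transitive, so any vertex of a component may replace the
  one from which the component was generated. Hence components with a common vertex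
  coincide.\<close>

lemma component_eq:
  assumes "C \<in> components G" "u \<in> verts C"
  shows "C = induced_subgraph G {v. (u, v) \<in> (adj G)\<^sup>*}"
proof -
  obtain w where w: "C = induced_subgraph G {v. (w, v) \<in> (adj G)\<^sup>*}"
    using assms(1) by (auto simp: components_def)
  then have "(w, u) \<in> (adj G)\<^sup>*"
    using assms(2) by (simp add: induced_subgraph_def)
  then have "{v. (w, v) \<in> (adj G)\<^sup>*} = {v. (u, v) \<in> (adj G)\<^sup>*}"
    by (auto intro: rtrancl_trans dest: adj_rtrancl_sym)
  with w show ?thesis by simp
qed

lemma component_unique:
  "C \<in> components G \<Longrightarrow> D \<in> components G \<Longrightarrow> u \<in> verts C \<Longrightarrow> u \<in> verts D \<Longrightarrow> C = D"
  by (metis component_eq)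

lemma component_reachable:
  assumes "C \<in> components G" "u \<in> verts C" "(u, v) \<in> (adj G)\<^sup>*"
  shows "v \<in> verts C"
proof -
  have "v \<in> verts (induced_subgraph G {v. (u, v) \<in> (adj G)\<^sup>*})"
    using assms(3) by (simp add: induced_subgraph_def)
  then show ?thesis using component_eq[OF assms(1,2)] by simp
qed

text \<open>Only \<open>u\<close> is required to lie in \<open>C\<close>: an edge of
  \<open>G\<close> at \<open>u\<close> makes its other end reachable, so the edge survives in the
  induced subgraph.\<close>

lemma component_adj_iff:
  assumes "C \<in> components G" "u \<in> verts C"
  shows "(u, v) \<in> adj C \<longleftrightarrow> (u, v) \<in> adj G"
proof
  assume "(u, v) \<in> adj C"
  then show "(u, v) \<in> adj G"
    using component_edges_subset[OF assms(1)] by (auto simp: adj_def)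
next
  assume uv: "(u, v) \<in> adj G"
  then have "v \<in> verts C" using component_reachable[OF assms] by blast
  with uv show "(u, v) \<in> adj C"
    using assms by (auto simp: adj_def components_def induced_subgraph_def)
qed

lemma component_edgeI:
  assumes "simple_graph G" "C \<in> components G" "u \<in> verts C" "e \<in> edges G" "u \<in> e"
  shows "e \<in> edges C"
proof -
  obtain v where "e = {u, v}" by (rule edge_other_end[OF assms(1,4,5)])
  then show ?thesis using component_adj_iff[OF assms(2,3), of v] assms(4) by (simp add: adj_def)
qed

lemma edges_in_component:
  assumes "simple_graph G" "e \<in> edges G"
  obtains C where "C \<in> components G" "e \<in> edges C"
proof -
  have "card e = 2" "e \<subseteq> verts G" using assms by (auto simp: simple_graph_def)
  then obtain u where u: "u \<in> e" "u \<in> verts G" by (auto simp: card_2_iff)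
  obtain C where "C \<in> components G" "u \<in> verts C" by (rule verts_in_component[OF u(2)])
  then show thesis using component_edgeI[OF assms(1) _ _ assms(2) u(1)] that by blast
qed

section \<open>Distances and total neighborhoods inside a component\<close>

text \<open>A walk of \<open>G\<close> starting in \<open>C\<close> never leaves \<open>C\<close>.
  This is why distances from \<open>u\<close> agree in \<open>C\<close> and \<open>G\<close>,
  whatever the end vertex.\<close>

lemma component_walk_iff:
  assumes "C \<in> components G" "u \<in> verts C"
  shows "(u, v) \<in> adj C ^^ n \<longleftrightarrow> (u, v) \<in> adj G ^^ n"
proof (induction n arbitrary: v)
  case (Suc n)
  have "w \<in> verts C" if "(u, w) \<in> adj G ^^ n" for w
    using component_reachable[OF assms] that by (simp add: relpow_imp_rtrancl)
  then show ?case
    using Suc component_adj_iff[OF assms(1)] by (auto simp: relcomp_unfold)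
qed simp

lemma component_graph_dist:
  "C \<in> components G \<Longrightarrow> u \<in> verts C \<Longrightarrow> graph_dist C u v = graph_dist G u v"
  by (simp add: graph_dist_def component_walk_iff)

text \<open>Without a walk the infimum is taken over the empty set and equals \<infinity>, which no
  real bound \<open>r\<close> reaches. So distinguishing at distance at most \<open>r\<close>
  concerns only vertices of one component.\<close>

lemma graph_dist_finite_reachable:
  assumes "ereal_of_enat (graph_dist G u v) \<le> ereal r"
  shows "(u, v) \<in> (adj G)\<^sup>*"
proof (rule ccontr)
  assume "(u, v) \<notin> (adj G)\<^sup>*"
  then have none: "{enat n | n. (u, v) \<in> adj G ^^ n} = {}"
    by (auto dest: relpow_imp_rtrancl)
  have "graph_dist G u v = \<infinity>"
    unfolding graph_dist_def none by (simp add: top_enat_def)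
  with assms show False by simp
qed

lemma component_total_nbhd:
  assumes "simple_graph G" "C \<in> components G" "u \<in> verts C"
  shows "total_nbhd C u = total_nbhd G u"
proof -
  have "v \<in> verts C" if "{u, v} \<in> edges G" for v
    using component_reachable[OF assms(2,3), of v] that by (auto simp: adj_def)
  then have "nbhd C u = nbhd G u"
    using component_adj_iff[OF assms(2,3)] component_verts_subset[OF assms(1,2)]
    by (auto simp: nbhd_def adj_def)
  then show ?thesis by (simp add: total_nbhd_def closed_nbhd_def)
qed

section \<open>Admissibility of a fixed coloring, component by component\<close>

text \<open>Each constraint of properness links two adjacent or incident elements, and these lie in
  a common component.\<close>

lemma proper_total_coloring_components_iff:
  assumes G: "simple_graph G"
  shows "proper_total_coloring G \<kappa> f \<longleftrightarrow> (\<forall>C\<in>components G. proper_total_coloring C \<kappa> f)"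
    (is "?L \<longleftrightarrow> ?R")
proof
  assume ?L
  show ?R
  proof
    fix C assume C: "C \<in> components G"
    have V: "u \<in> verts G" if "u \<in> verts C" for u
      using component_verts_subset[OF G C] that by blast
    have E: "e \<in> edges G" if "e \<in> edges C" for e
      using component_edges_subset[OF C] that by blast
    have "x \<in> verts G <+> edges G" if "x \<in> verts C <+> edges C" for x
      using that V E by auto
    then show "proper_total_coloring C \<kappa> f"
      using \<open>?L\<close> V E by (simp add: proper_total_coloring_def Pi_iff)
  qed
next
  assume R: ?R
  have Rv: "f (Inl v) \<in> {1..\<kappa>}" if "C \<in> components G" "v \<in> verts C" for C v
    using R that by (auto simp: proper_total_coloring_def Pi_iff)
  have Re: "f (Inr e) \<in> {1..\<kappa>}" if "C \<in> components G" "e \<in> edges C" for C e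
    using R that by (auto simp: proper_total_coloring_def Pi_iff)
  show ?L
    unfolding proper_total_coloring_def
  proof (intro conjI ballI impI)
    show "f \<in> verts G <+> edges G \<rightarrow> {1..\<kappa>}"
    proof
      fix x assume "x \<in> verts G <+> edges G"
      then show "f x \<in> {1..\<kappa>}"
      proof
        fix v assume v: "x = Inl v" "v \<in> verts G"
        obtain C where "C \<in> components G" "v \<in> verts C" by (rule verts_in_component[OF v(2)])
        then show ?thesis using Rv v(1) by simp
      next
        fix e assume e: "x = Inr e" "e \<in> edges G"
        obtain C where "C \<in> components G" "e \<in> edges C" by (rule edges_in_component[OF G e(2)])
        then show ?thesis using Re e(1) by simp
      qed
    qed
  next
    fix u v assume "u \<in> verts G" and e: "{u, v} \<in> edges G"
    obtain C where C: "C \<in> components G" "{u, v} \<in> edges C"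
      by (rule edges_in_component[OF G e])
    then show "f (Inl u) \<noteq> f (Inl v)"
      using R component_edge_verts[OF C] by (simp add: proper_total_coloring_def)
  next
    fix e e' assume e: "e \<in> edges G" "e' \<in> edges G" and ne: "e \<noteq> e' \<and> e \<inter> e' \<noteq> {}"
    obtain C where C: "C \<in> components G" "e \<in> edges C"
      by (rule edges_in_component[OF G e(1)])
    \<comment> \<open>The shared endpoint carries \<open>e'\<close> into the component that contains
      \<open>e\<close>.\<close>
    obtain u where u: "u \<in> e" "u \<in> e'" using ne by blast
    then have "u \<in> verts C" using component_edge_verts[OF C] by blast
    then have "e' \<in> edges C" using component_edgeI[OF G C(1) _ e(2) u(2)] by blast
    then show "f (Inr e) \<noteq> f (Inr e')"
      using R C ne by (simp add: proper_total_coloring_def)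
  next
    fix v e assume e: "e \<in> edges G" "v \<in> e"
    obtain C where C: "C \<in> components G" "e \<in> edges C"
      by (rule edges_in_component[OF G e(1)])
    then have "v \<in> verts C" using component_edge_verts[OF C] e(2) by blast
    then show "f (Inl v) \<noteq> f (Inr e)"
      using R C e(2) by (simp add: proper_total_coloring_def)
  qed
qed

lemma vsdtc_components_iff:
  assumes G: "simple_graph G"
  shows "vsdtc r G \<kappa> f \<longleftrightarrow> (\<forall>C\<in>components G. vsdtc r C \<kappa> f)"
proof -
  have col: "color_set C f u = color_set G f u" if "C \<in> components G" "u \<in> verts C" for C u
    by (simp add: color_set_def component_total_nbhd[OF G that])
  have "(\<forall>u\<in>verts G. \<forall>v\<in>verts G. u \<noteq> v \<and> ereal_of_enat (graph_dist G u v) \<le> ereal r \<longrightarrow>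
          color_set G f u \<noteq> color_set G f v) \<longleftrightarrow>
        (\<forall>C\<in>components G. \<forall>u\<in>verts C. \<forall>v\<in>verts C.
          u \<noteq> v \<and> ereal_of_enat (graph_dist C u v) \<le> ereal r \<longrightarrow>
          color_set C f u \<noteq> color_set C f v)" (is "?L \<longleftrightarrow> ?R")
  proof
    assume ?L
    show ?R
    proof (intro ballI impI)
      fix C u v
      assume C: "C \<in> components G" and uv: "u \<in> verts C" "v \<in> verts C"
        and d: "u \<noteq> v \<and> ereal_of_enat (graph_dist C u v) \<le> ereal r"
      have "u \<in> verts G" "v \<in> verts G" using component_verts_subset[OF G C] uv by blast+
      then show "color_set C f u \<noteq> color_set C f v"
        using \<open>?L\<close> d component_graph_dist[OF C uv(1), of v] col[OF C uv(1)] col[OF C uv(2)] by simp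
    qed
  next
    assume R: ?R
    show ?L
    proof (intro ballI impI)
      fix u v
      assume u: "u \<in> verts G" and uv: "u \<noteq> v \<and> ereal_of_enat (graph_dist G u v) \<le> ereal r"
      obtain C where C: "C \<in> components G" "u \<in> verts C" by (rule verts_in_component[OF u])
      \<comment> \<open>The distance bound makes \<open>v\<close> reachable from \<open>u\<close>,
        so the hypothesis on the single component \<open>C\<close> applies.\<close>
      have v: "v \<in> verts C"
        by (rule component_reachable[OF C graph_dist_finite_reachable[OF conjunct2[OF uv]]])
      have "color_set C f u \<noteq> color_set C f v"
        using R C v uv component_graph_dist[OF C, of v] by simp
      then show "color_set G f u \<noteq> color_set G f v"
        using col[OF C] col[OF C(1) v] by simp
    qed
  qed
  then show ?thesis
    unfolding vsdtc_def proper_total_coloring_components_iff[OF G] ball_conj_distrib by simp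
qed

section \<open>Gluing colorings of the components\<close>

text \<open>Allows a coloring of a component to be replaced by the glued one, which agrees with it
  on that component only.\<close>

lemma vsdtc_cong:
  assumes fg: "\<And>x. x \<in> verts G <+> edges G \<Longrightarrow> f x = g x" and f: "vsdtc r G \<kappa> f"
  shows "vsdtc r G \<kappa> g"
proof -
  have l: "f (Inl u) = g (Inl u)" if "u \<in> verts G" for u using fg that by blast
  have e: "f (Inr a) = g (Inr a)" if "a \<in> edges G" for a using fg that by blast
  have "color_set G f u = color_set G g u" if "u \<in> verts G" for u
    unfolding color_set_def
  proof (rule image_cong)
    fix x assume "x \<in> total_nbhd G u"
    then have "x \<in> verts G <+> edges G"
      using that by (auto simp: total_nbhd_def closed_nbhd_def nbhd_def)
    then show "f x = g x" by (rule fg)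
  qed simp
  moreover have "proper_total_coloring G \<kappa> g"
    using f l e fg unfolding vsdtc_def proper_total_coloring_def Pi_def by simp
  ultimately show ?thesis using f unfolding vsdtc_def by simp
qed

lemma vsdtc_mono: "vsdtc r G \<kappa> f \<Longrightarrow> \<kappa> \<le> \<kappa>' \<Longrightarrow> vsdtc r G \<kappa>' f"
  by (auto simp: vsdtc_def proper_total_coloring_def Pi_iff intro: order_trans)

text \<open>Unlike in \<open>vsdtc_components_iff\<close>, the coloring may differ from one
  component to the next; disjointness of the components lets these choices be merged into one
  function.\<close>

lemma colorable_components_iff:
  assumes G: "simple_graph G"
  shows "(\<exists>f. vsdtc r G \<kappa> f) \<longleftrightarrow> (\<forall>C\<in>components G. \<exists>f. vsdtc r C \<kappa> f)"
proof
  assume "\<exists>f. vsdtc r G \<kappa> f"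
  then show "\<forall>C\<in>components G. \<exists>f. vsdtc r C \<kappa> f"
    using vsdtc_components_iff[OF G] by blast
next
  assume "\<forall>C\<in>components G. \<exists>f. vsdtc r C \<kappa> f"
  then obtain F where F: "\<And>C. C \<in> components G \<Longrightarrow> vsdtc r C \<kappa> (F C)" by metis
  \<comment> \<open>\<open>g\<close> colors each element as the coloring chosen for its component
    does; on arguments outside all components its value is irrelevant.\<close>
  define g where
    "g x = F (THE C. C \<in> components G \<and> x \<in> verts C <+> edges C) x" for x
  have "vsdtc r C \<kappa> g" if C: "C \<in> components G" for C
  proof (rule vsdtc_cong[OF _ F[OF C]])
    fix x assume x: "x \<in> verts C <+> edges C"
    have unique: "D = C" if D: "D \<in> components G" "x \<in> verts D <+> edges D" for D
    proof (cases x)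
      case (Inl u)
      then show ?thesis using component_unique[OF D(1) C] D(2) x by auto
    next
      case (Inr e)
      then have e: "e \<in> edges C" "e \<in> edges D" using x D by auto
      then have "card e = 2"
        using G component_edges_subset[OF C] by (auto simp: simple_graph_def)
      \<comment> \<open>An edge has an endpoint, which reduces uniqueness for edges to uniqueness
        for vertices.\<close>
      then obtain u where "u \<in> e" by (auto simp: card_2_iff)
      then show ?thesis
        using component_unique[OF D(1) C] e component_edge_verts C D(1) by blast
    qed
    have "(THE D. D \<in> components G \<and> x \<in> verts D <+> edges D) = C"
      by (rule the_equality) (use C x unique in blast)+
    then show "F C x = g x" by (simp add: g_def)
  qed
  then show "\<exists>f. vsdtc r G \<kappa> f" using vsdtc_components_iff[OF G] by blast
qed

section \<open>Existence of an admissible coloring\<close>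

text \<open>The edge \<open>{u, w}\<close> belongs to the total neighborhood of \<open>u\<close>,
  hence to that of \<open>v\<close>, so \<open>v\<close> is one of its ends.\<close>

lemma total_nbhd_eq_imp_only_nbr:
  assumes "simple_graph G" "total_nbhd G u = total_nbhd G v" "u \<noteq> v" "(u, w) \<in> adj G"
  shows "w = v"
proof -
  have "Inr {u, w} \<in> total_nbhd G u"
    using assms(4) adj_verts[OF assms(1,4)] by (auto simp: total_nbhd_def nbhd_def adj_def)
  then have "Inr {u, w} \<in> total_nbhd G v" using assms(2) by simp
  then have "v \<in> {u, w}" by (auto simp: total_nbhd_def)
  then show ?thesis using assms(3) by blast
qed

lemma total_nbhd_inj:
  assumes G: "simple_graph G" and iso: "no_isolated_edges G"
    and u: "u \<in> verts G" and uv: "(u, v) \<in> (adj G)\<^sup>*" and ne: "u \<noteq> v"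
  shows "total_nbhd G u \<noteq> total_nbhd G v"
proof
  assume eq: "total_nbhd G u = total_nbhd G v"
  note only = total_nbhd_eq_imp_only_nbr[OF G eq ne]
    total_nbhd_eq_imp_only_nbr[OF G eq[symmetric] ne[symmetric]]
  \<comment> \<open>The walk from \<open>u\<close> to \<open>v\<close> is nontrivial; its first step
    must already end in \<open>v\<close>, the only possible neighbor of \<open>u\<close>.\<close>
  obtain w where "(u, w) \<in> adj G" using uv ne by (metis converse_rtranclE)
  then have e: "(u, v) \<in> adj G" using only by metis
  let ?S = "{x. (u, x) \<in> (adj G)\<^sup>*}"
  \<comment> \<open>Each of \<open>u\<close> and \<open>v\<close> has only the other as a neighbor,
    so no walk from \<open>u\<close> leaves the pair.\<close>
  have "x \<in> {u, v}" if "(u, x) \<in> (adj G)\<^sup>*" for x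
    using that by induction (auto dest: only)
  then have S: "?S = {u, v}" using uv by auto
  have "{e \<in> edges G. e \<subseteq> {u, v}} = {{u, v}}"
  proof -
    have "a = {u, v}" if "a \<in> edges G" "a \<subseteq> {u, v}" for a
    proof (rule card_subset_eq)
      show "card a = card {u, v}" using G that ne by (auto simp: simple_graph_def)
    qed (use that in auto)
    then show ?thesis using e by (auto simp: adj_def)
  qed
  then have "is_K2 (induced_subgraph G ?S)"
    unfolding S is_K2_def using ne by (auto simp: induced_subgraph_def)
  moreover have "induced_subgraph G ?S \<in> components G"
    using u by (auto simp: components_def)
  ultimately show False using iso by (auto simp: no_isolated_edges_def)
qed

lemma colorable_exists:
  assumes G: "simple_graph G" and iso: "no_isolated_edges G"
  shows "\<exists>\<kappa> f. vsdtc r G \<kappa> f"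
proof -
  let ?X = "verts G <+> edges G"
  have "finite ?X" using G finite_edges[OF G] by (simp add: simple_graph_def)
  \<comment> \<open>Numbering starts at 1 to match the color range, and every vertex and edge gets
    its own color.\<close>
  then obtain f where f: "bij_betw f ?X {1..card ?X}"
    using ex_bij_betw_nat_finite_1 bij_betw_inv by blast
  then have inj: "inj_on f ?X" by (rule bij_betw_imp_inj_on)
  have proper: "proper_total_coloring G (card ?X) f"
    unfolding proper_total_coloring_def
  proof (intro conjI ballI impI)
    show "f \<in> ?X \<rightarrow> {1..card ?X}" using f by (rule bij_betw_imp_funcset)
  next
    fix u v assume "u \<in> verts G" "v \<in> verts G" and e: "{u, v} \<in> edges G"
    moreover have "u \<noteq> v" using adj_verts(3)[OF G] e by (simp add: adj_def)
    ultimately show "f (Inl u) \<noteq> f (Inl v)" using inj by (auto dest: inj_onD)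
  qed (use inj in \<open>auto dest: inj_onD\<close>)
  have sub: "total_nbhd G u \<subseteq> ?X" if "u \<in> verts G" for u
    using that by (auto simp: total_nbhd_def closed_nbhd_def nbhd_def)
  have "color_set G f u \<noteq> color_set G f v"
    if "u \<in> verts G" "v \<in> verts G" "u \<noteq> v" "ereal_of_enat (graph_dist G u v) \<le> ereal r" for u v
    \<comment> \<open>As \<open>f\<close> is injective, equal color sets would force equal total
      neighborhoods.\<close>
    using total_nbhd_inj[OF G iso that(1) graph_dist_finite_reachable[OF that(4)] that(3)]
      inj_on_image_eq_iff[OF inj sub[OF that(1)] sub[OF that(2)]]
    by (simp add: color_set_def)
  then show ?thesis using proper unfolding vsdtc_def by blast
qed

section \<open>Comparison of the minima\<close>

text \<open>The minimum is attained once some coloring exists, and spare colors do no harm. The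
  minimum is thereby described by its upper bounds, the form in which it can be compared with a
  maximum.\<close>

lemma chi_vsdt_le_iff:
  assumes "\<exists>\<kappa> f. vsdtc r G \<kappa> f"
  shows "chi_vsdt r G \<le> \<kappa> \<longleftrightarrow> (\<exists>f. vsdtc r G \<kappa> f)"
proof
  have "\<exists>f. vsdtc r G (chi_vsdt r G) f"
    unfolding chi_vsdt_def using assms by (rule LeastI_ex)
  then show "\<exists>f. vsdtc r G \<kappa> f" if "chi_vsdt r G \<le> \<kappa>" using vsdtc_mono that by blast
next
  show "chi_vsdt r G \<le> \<kappa>" if "\<exists>f. vsdtc r G \<kappa> f"
    unfolding chi_vsdt_def using that by (rule Least_le)
qed

theorem theorem1p4:
  fixes r :: real and G :: "'a ugraph" and m :: nat and H :: "nat \<Rightarrow> 'a ugraph"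
  assumes "r > 0"
    and "simple_graph G"
    and "no_isolated_edges G"
    and "bij_betw H {1..m} (components G)"
  shows "chi_vsdt r G = (MAX i\<in>{1..m}. chi_vsdt r (H i))"
proof -
  note G = assms(2)
  have H: "H ` {1..m} = components G" using assms(4) by (rule bij_betw_imp_surj_on)
  have exG: "\<exists>\<kappa> f. vsdtc r G \<kappa> f" by (rule colorable_exists[OF assms(2,3)])
  then have exC: "\<exists>\<kappa> f. vsdtc r C \<kappa> f" if "C \<in> components G" for C
    using vsdtc_components_iff[OF G] that by blast
  \<comment> \<open>A graph has a vertex, hence a component, so the maximum ranges over a nonempty
    set.\<close>
  have "components G \<noteq> {}" using G by (auto simp: simple_graph_def components_def)
  then have "{1..m} \<noteq> {}" using H by auto
  then have "(MAX i\<in>{1..m}. chi_vsdt r (H i)) \<le> \<kappa> \<longleftrightarrow> (\<forall>C\<in>components G. chi_vsdt r C \<le> \<kappa>)" for \<kappa>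
    unfolding H[symmetric] by (subst Max_le_iff) auto
  moreover have "(\<forall>C\<in>components G. chi_vsdt r C \<le> \<kappa>) \<longleftrightarrow> chi_vsdt r G \<le> \<kappa>" for \<kappa>
    using chi_vsdt_le_iff[OF exC] chi_vsdt_le_iff[OF exG] colorable_components_iff[OF G] by simp
  \<comment> \<open>Both sides have the same upper bounds \<kappa>; taking each side as \<kappa>
    gives equality.\<close>
  ultimately show ?thesis by (metis order_antisym order_refl)
qed

end
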